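(* Let $a$ and $k$ be relatively prime positive integers and let $S=\langle a,a+k,a+2k\rangle$. Let $d$ be a positive divisor of $a$, and write $a=sd$. If $a$ is odd, then $$2g(S/d)-F(S/d)=\frac{s+1}{2}.$$
   Context: $\mathbb{N}$ denotes the set of nonnegative integers. A numerical semigroup is a subset of $\mathbb{N}$ that is closed under addition, contains $0$, and has finite complement in $\mathbb{N}$. For positive integers $a_1,\ldots,a_n$ with $\gcd(a_1,\ldots,a_n)=1$, $\langle a_1,\ldots,a_n\rangle=\{c_1a_1+\cdots+c_na_n: c_1,\ldots,c_n\in\mathbb{N}\}$, which is a numerical semigroup. For a numerical semigroup $S$ and a positive integer $d$, $S/d=\{x\in\mathbb{N}: dx\in S\}$, which is again a numerical semigroup. The genus and Frobenius number of a numerical semigroup $S$ are $g(S)=|\mathbb{N}\setminus S|$ and $F(S)=\max(\mathbb{N}\setminus S)$, with the convention $F(\mathbb{N})=-1$. *)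

theory Defs
  imports Complex_Main
begin

definition generated_semigroup :: "nat list \<Rightarrow> nat set" where
  "generated_semigroup as = {(\<Sum>i<length as. c i * as ! i) | c :: nat \<Rightarrow> nat. True}"

definition semigroup_quotient :: "nat set \<Rightarrow> nat \<Rightarrow> nat set" where
  "semigroup_quotient S d = {x. d * x \<in> S}"

(* genus and frobenius_number are meaningful only for sets with finite complement,
   in particular for numerical semigroups; otherwise card and Max return default values. *)

definition genus :: "nat set \<Rightarrow> nat" where
  "genus S = card (UNIV - S)"

definition frobenius_number :: "nat set \<Rightarrow> int" where
  "frobenius_number S = (if S = UNIV then - 1 else int (Max (UNIV - S)))"

end

theory Submission
  imports Defs
begin

text \<open>
  An element of \<open>\<langle>a, a + k, a + 2k\<rangle>\<close> is a number \<open>m a + j k\<close> with \<open>j \<le> 2 m\<close>. If \<open>d\<close> divides \<open>a = s d\<close>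
  and such a number is a multiple of \<open>d\<close>, then \<open>d\<close> divides \<open>j\<close>, because \<open>k\<close> is prime to \<open>d\<close>. Dividing
  by \<open>d\<close> and trading a multiple of \<open>s\<close> in \<open>j / d\<close> for copies of \<open>s\<close> shows that \<open>S/d\<close> consists of the
  numbers \<open>w i + s q\<close> with \<open>i < s\<close>, where \<open>w i = i k + s \<lceil>d i / 2\<rceil>\<close>
  (\<open>mem_quotient_three_term_iff\<close>). As \<open>k\<close> is prime to \<open>s\<close>, the \<open>w i\<close> represent every residue class
  modulo \<open>s\<close> once: they form the Apery set of \<open>S/d\<close> with respect to \<open>s\<close>.

  Selmer's formulas (\<open>genus_of_apery\<close>, \<open>frobenius_number_of_apery\<close>) now give the genus from the sum of
  the \<open>w i\<close>, and the Frobenius number as \<open>max w - s\<close>. Since \<open>w\<close> is increasing, its maximum is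
  \<open>w (s - 1)\<close>. Because \<open>a\<close> is odd, \<open>s = 2 r + 1\<close> and \<open>d\<close> are odd, so \<open>\<lceil>d i / 2\<rceil>\<close> exceeds \<open>d i / 2\<close> by
  one half for precisely the \<open>r\<close> odd indices \<open>i\<close>, whereas at \<open>i = s - 1 = 2 r\<close> there is no rounding.
  Hence
  \<open>2 g + 2 r = 2 k r + d r s + r\<close> and \<open>F = 2 k r + d r s - s\<close>, so \<open>2 g - F = s - r = r + 1\<close>.
\<close>

section \<open>Selmer's formulas\<close>

text \<open>Within the residue class of \<open>w i\<close>, the elements of \<open>T\<close> are exactly those from \<open>w i\<close> onwards, so
  the gaps split into one initial segment per class.\<close>

lemma gaps_of_apery:
  fixes w :: "nat \<Rightarrow> nat"
  assumes bij: "bij_betw (\<lambda>i. w i mod s) {..<s} {..<s}"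
    and T: "T = {w i + s * q | i q. i < s}" and "s > 0"
  shows "UNIV - T = (\<Union>i<s. {x. x mod s = w i mod s \<and> x < w i})"
proof (intro equalityI subsetI)
  fix x assume x: "x \<in> UNIV - T"
  have "x mod s \<in> (\<lambda>i. w i mod s) ` {..<s}"
    using bij \<open>s > 0\<close> by (simp add: bij_betw_def)
  then obtain i where i: "i < s" "x mod s = w i mod s" by auto
  have "x < w i"
  proof (rule ccontr)
    assume "\<not> x < w i"
    then have "w i \<le> x" by simp
    with i(2) obtain q where "x = w i + s * q" by (rule mod_eq_nat1E)
    then have "x \<in> T" unfolding T using i(1) by blast
    then show False using x by simp
  qed
  then show "x \<in> (\<Union>i<s. {x. x mod s = w i mod s \<and> x < w i})" using i by auto
next
  fix x assume "x \<in> (\<Union>i<s. {x. x mod s = w i mod s \<and> x < w i})"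
  then obtain i where i: "i < s" "x mod s = w i mod s" "x < w i" by auto
  have "x \<noteq> w j + s * q" if "j < s" for j q
  proof
    assume x: "x = w j + s * q"
    then have "w j mod s = w i mod s" using i(2) by simp
    then have "j = i"
      by (rule inj_onD[OF bij_betw_imp_inj_on[OF bij]]) (simp_all add: i(1) that)
    then show False using x i(3) by simp
  qed
  then show "x \<in> UNIV - T" unfolding T by blast
qed

lemma card_residue_class_below:
  fixes n s :: nat
  assumes "s > 0"
  shows "card {x. x mod s = n mod s \<and> x < n} = n div s"
proof -
  have "{x. x mod s = n mod s \<and> x < n} = (\<lambda>t. n mod s + s * t) ` {..<n div s}"
  proof (intro equalityI subsetI)
    fix x assume "x \<in> {x. x mod s = n mod s \<and> x < n}"
    then have x: "x mod s = n mod s" "x < n" by auto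
    have eq: "x = n mod s + s * (x div s)" using x(1) by (metis mod_mult_div_eq)
    moreover have "x div s < n div s"
      using x by (metis div_le_mono div_mult_mod_eq less_imp_le_nat nat_less_le)
    ultimately show "x \<in> (\<lambda>t. n mod s + s * t) ` {..<n div s}" by blast
  next
    fix x assume "x \<in> (\<lambda>t. n mod s + s * t) ` {..<n div s}"
    then obtain t where t: "t < n div s" "x = n mod s + s * t" by auto
    have "s * t < s * (n div s)" using t(1) assms by simp
    then have "x < n" using t(2) mod_mult_div_eq[of n s] by linarith
    then show "x \<in> {x. x mod s = n mod s \<and> x < n}" using t(2) by simp
  qed
  moreover have "inj_on (\<lambda>t. n mod s + s * t) {..<n div s}"
    using assms by (auto simp: inj_on_def)
  ultimately show ?thesis by (simp add: card_image)
qed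

text \<open>The class of \<open>w i\<close> contributes \<open>w i div s\<close> gaps, and the remainders \<open>w i mod s\<close> run through
  \<open>0, \<dots>, s - 1\<close>.\<close>

lemma genus_of_apery:
  fixes w :: "nat \<Rightarrow> nat"
  assumes bij: "bij_betw (\<lambda>i. w i mod s) {..<s} {..<s}"
    and T: "T = {w i + s * q | i q. i < s}" and "s > 0"
  shows "s * genus T + (\<Sum>i<s. i) = (\<Sum>i<s. w i)"
proof -
  have "genus T = (\<Sum>i<s. card {x. x mod s = w i mod s \<and> x < w i})"
    unfolding genus_def gaps_of_apery[OF assms]
  proof (rule card_UN_disjoint)
    show "\<forall>i\<in>{..<s}. \<forall>j\<in>{..<s}. i \<noteq> j \<longrightarrow>
        {x. x mod s = w i mod s \<and> x < w i} \<inter> {x. x mod s = w j mod s \<and> x < w j} = {}"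
    proof (intro ballI impI)
      fix i j assume "i \<in> {..<s}" "j \<in> {..<s}" "i \<noteq> j"
      then have "w i mod s \<noteq> w j mod s"
        using inj_onD[OF bij_betw_imp_inj_on[OF bij]] by blast
      then show "{x. x mod s = w i mod s \<and> x < w i} \<inter> {x. x mod s = w j mod s \<and> x < w j} = {}"
        by auto
    qed
  qed auto
  then have "genus T = (\<Sum>i<s. w i div s)"
    using card_residue_class_below[OF \<open>s > 0\<close>] by simp
  moreover have "(\<Sum>i<s. i) = (\<Sum>i<s. w i mod s)"
    using sum.reindex_bij_betw[OF bij, of "\<lambda>i. i"] by simp
  ultimately have "s * genus T + (\<Sum>i<s. i) = (\<Sum>i<s. s * (w i div s) + w i mod s)"
    by (simp only: sum.distrib sum_distrib_left)
  then show ?thesis by simp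
qed

text \<open>The largest gap in the class of \<open>w i\<close> is \<open>w i - s\<close>. This is negative for every \<open>i\<close> only when
  \<open>T = \<nat>\<close>; then \<open>w m = s - 1\<close>, so the convention \<open>F(\<nat>) = -1\<close> fits the same formula.\<close>

lemma frobenius_number_of_apery:
  fixes w :: "nat \<Rightarrow> nat"
  assumes bij: "bij_betw (\<lambda>i. w i mod s) {..<s} {..<s}"
    and T: "T = {w i + s * q | i q. i < s}" and "s > 0"
    and m: "m < s" "\<And>i. i < s \<Longrightarrow> w i \<le> w m"
  shows "frobenius_number T = int (w m) - int s"
proof (cases "s \<le> w m")
  case True
  have below: "x \<le> w m - s" if x: "x \<in> UNIV - T" for x
  proof -
    obtain i where i: "i < s" "x mod s = w i mod s" "x < w i"
      using x unfolding gaps_of_apery[OF bij T \<open>s > 0\<close>] by blast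
    then have "s dvd w i - x" using mod_eq_dvd_iff_nat[of x "w i" s] by simp
    then have "s \<le> w i - x" using i(3) by (simp add: dvd_imp_le)
    then show ?thesis using m(2)[OF i(1)] i(3) by linarith
  qed
  have "w m - s \<in> {x. x mod s = w m mod s \<and> x < w m}"
    using True \<open>s > 0\<close> by (simp add: le_mod_geq)
  then have gap: "w m - s \<in> UNIV - T"
    unfolding gaps_of_apery[OF bij T \<open>s > 0\<close>] using m(1) by blast
  have "finite (UNIV - T)" using below by (meson finite_nat_set_iff_bounded_le)
  then have "Max (UNIV - T) = w m - s" using below gap by (intro Max_eqI) auto
  moreover have "T \<noteq> UNIV" using gap by auto
  ultimately show ?thesis using True by (simp add: frobenius_number_def of_nat_diff)
next
  case False
  then have small: "w i < s" if "i < s" for i using m(2)[OF that] by simp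
  have "x \<notin> UNIV - T" for x
  proof
    assume "x \<in> UNIV - T"
    then obtain i where i: "i < s" "x mod s = w i mod s" "x < w i"
      unfolding gaps_of_apery[OF bij T \<open>s > 0\<close>] by blast
    then show False using small[OF i(1)] by simp
  qed
  then have "T = UNIV" by blast
  have "s - 1 \<in> (\<lambda>i. w i mod s) ` {..<s}" using bij \<open>s > 0\<close> by (simp add: bij_betw_def)
  then obtain i where "i < s" "s - 1 = w i mod s" by blast
  then have "i < s" "s - 1 = w i" using small[of i] by simp_all
  then have "w m = s - 1" using m(2)[of i] False by linarith
  then show ?thesis using \<open>T = UNIV\<close> \<open>s > 0\<close> by (simp add: frobenius_number_def)
qed

section \<open>Quotients of three-term arithmetic semigroups\<close>

lemma mem_three_term_semigroup_iff:
  "n \<in> generated_semigroup [a, a + k, a + 2 * k] \<longleftrightarrow> (\<exists>m j. j \<le> 2 * m \<and> n = m * a + j * k)"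
proof
  assume "n \<in> generated_semigroup [a, a + k, a + 2 * k]"
  then obtain c :: "nat \<Rightarrow> nat" where "n = c 0 * a + c 1 * (a + k) + c 2 * (a + 2 * k)"
    by (auto simp: generated_semigroup_def numeral_eq_Suc)
  then have "n = (c 0 + c 1 + c 2) * a + (c 1 + 2 * c 2) * k" by (simp add: algebra_simps)
  moreover have "c 1 + 2 * c 2 \<le> 2 * (c 0 + c 1 + c 2)" by simp
  ultimately show "\<exists>m j. j \<le> 2 * m \<and> n = m * a + j * k" by blast
next
  assume "\<exists>m j. j \<le> 2 * m \<and> n = m * a + j * k"
  then obtain m j where mj: "j \<le> 2 * m" "n = m * a + j * k" by auto
  obtain p q r where "m = p + q + r" "j = q + 2 * r"
  proof (cases "j \<le> m")
    case True
    then show ?thesis using that[of "m - j" j 0] by simp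
  next
    case False
    then show ?thesis using that[of 0 "2 * m - j" "j - m"] mj(1) by simp
  qed
  then have "n = p * a + q * (a + k) + r * (a + 2 * k)" using mj(2) by (simp add: algebra_simps)
  then have "n = (\<Sum>i<length [a, a + k, a + 2 * k]. [p, q, r] ! i * [a, a + k, a + 2 * k] ! i)"
    by (simp add: numeral_eq_Suc)
  then show "n \<in> generated_semigroup [a, a + k, a + 2 * k]"
    unfolding generated_semigroup_def by blast
qed

text \<open>Replacing \<open>j\<close> by a smaller number in its class modulo \<open>a\<close> raises \<open>m\<close> and only relaxes
  \<open>j \<le> 2 m\<close>; hence the coefficient of \<open>k\<close> may be taken to be \<open>d i\<close> with \<open>i < s\<close>, and the remaining
  condition \<open>d i \<le> 2 m\<close> says \<open>m \<ge> \<lceil>d i / 2\<rceil>\<close>.\<close>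

lemma mem_quotient_three_term_iff:
  fixes d k s :: nat
  assumes "coprime d k" and "d > 0" and "s > 0"
  shows "x \<in> semigroup_quotient (generated_semigroup [s * d, s * d + k, s * d + 2 * k]) d \<longleftrightarrow>
    (\<exists>i q. i < s \<and> x = (i * k + s * ((d * i + 1) div 2)) + s * q)"
proof
  assume "x \<in> semigroup_quotient (generated_semigroup [s * d, s * d + k, s * d + 2 * k]) d"
  then obtain m j where mj: "j \<le> 2 * m" "d * x = m * (s * d) + j * k"
    by (auto simp: semigroup_quotient_def mem_three_term_semigroup_iff)
  have "d dvd j * k" using mj(2) by (metis dvd_add_right_iff dvd_triv_left dvd_triv_right mult.assoc)
  then have "d dvd j" using assms(1) by (simp add: coprime_dvd_mult_left_iff)
  then obtain j' where j': "j = d * j'" by auto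
  have "d * x = d * (m * s + j' * k)" using mj(2) j' by (simp add: algebra_simps)
  then have x: "x = m * s + j' * k" using \<open>d > 0\<close> by simp
  define i t where "i = j' mod s" and "t = j' div s"
  have split: "j' = i + s * t" unfolding i_def t_def by simp
  have "d * i \<le> d * j'" using split by simp
  then have "(d * i + 1) div 2 \<le> m + t * k" using mj(1) j' by linarith
  then obtain q where q: "m + t * k = (d * i + 1) div 2 + q" using le_Suc_ex by blast
  have "x = i * k + s * (m + t * k)" using x split by (simp add: algebra_simps)
  then have "x = (i * k + s * ((d * i + 1) div 2)) + s * q"
    unfolding q by (simp add: algebra_simps)
  moreover have "i < s" using \<open>s > 0\<close> by (simp add: i_def)
  ultimately show "\<exists>i q. i < s \<and> x = (i * k + s * ((d * i + 1) div 2)) + s * q" by blast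
next
  assume "\<exists>i q. i < s \<and> x = (i * k + s * ((d * i + 1) div 2)) + s * q"
  then obtain i q where x: "x = (i * k + s * ((d * i + 1) div 2)) + s * q" by auto
  have "d * x = ((d * i + 1) div 2 + q) * (s * d) + (d * i) * k"
    unfolding x by (simp add: algebra_simps)
  moreover have "n \<le> 2 * ((n + 1) div 2 + q)" for n :: nat by presburger
  ultimately show "x \<in> semigroup_quotient (generated_semigroup [s * d, s * d + k, s * d + 2 * k]) d"
    unfolding semigroup_quotient_def mem_three_term_semigroup_iff by blast
qed

lemma bij_betw_mult_mod:
  fixes k s :: nat
  assumes "coprime s k" and "s > 0"
  shows "bij_betw (\<lambda>i. i * k mod s) {..<s} {..<s}"
proof -
  have "i = j" if "i < s" "j < s" "i * k mod s = j * k mod s" "i \<le> j" for i j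
  proof -
    have "s dvd j * k - i * k"
      using that(3,4) mod_eq_dvd_iff_nat[of "i * k" "j * k" s] by simp
    then have "s dvd (j - i) * k" by (simp add: diff_mult_distrib)
    then have "s dvd j - i" using assms(1) by (simp add: coprime_dvd_mult_left_iff)
    moreover have "j - i < s" using that(2) by simp
    ultimately have "j - i = 0" using nat_dvd_not_less[of "j - i" s] by blast
    then show ?thesis using that(4) by simp
  qed
  then have "inj_on (\<lambda>i. i * k mod s) {..<s}"
    by (metis (mono_tags, lifting) inj_onI lessThan_iff linear)
  moreover have "(\<lambda>i. i * k mod s) ` {..<s} \<subseteq> {..<s}" using \<open>s > 0\<close> by auto
  ultimately show ?thesis by (simp add: bij_betw_def endo_inj_surj)
qed

text \<open>The summand \<open>r\<close> is the total rounding error, one half for each odd index, doubled.\<close>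

lemma sum_half_ceiling_odd_multiples:
  fixes d r :: nat
  assumes "odd d"
  shows "2 * (\<Sum>i<2 * r + 1. (d * i + 1) div 2) = d * r * (2 * r + 1) + r"
proof -
  obtain e where d: "d = 2 * e + 1" using assms by (auto elim: oddE)
  show ?thesis
  proof (induction r)
    case 0
    show ?case by simp
  next
    case (Suc r)
    have "(d * (2 * r + 1) + 1) div 2 = d * r + e + 1"
      unfolding d by (simp add: algebra_simps)
    moreover have "(d * (2 * r + 2) + 1) div 2 = d * (r + 1)" by (simp add: algebra_simps)
    moreover have "(\<Sum>i<2 * Suc r + 1. (d * i + 1) div 2) = (\<Sum>i<2 * r + 1. (d * i + 1) div 2)
        + (d * (2 * r + 1) + 1) div 2 + (d * (2 * r + 2) + 1) div 2"
      by simp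
    ultimately have "2 * (\<Sum>i<2 * Suc r + 1. (d * i + 1) div 2)
        = (d * r * (2 * r + 1) + r) + 2 * (d * r + e + 1) + 2 * (d * (r + 1))"
      using Suc.IH by simp
    then show ?case unfolding d by (simp add: algebra_simps)
  qed
qed

theorem corollary3p6:
  fixes a k d s :: nat and S :: "nat set"
  assumes "a > 0" and "k > 0" and "coprime a k"
    and "S = generated_semigroup [a, a + k, a + 2 * k]"
    and "d > 0" and "d dvd a" and "a = s * d"
    and "odd a"
  shows "2 * real (genus (semigroup_quotient S d))
           - real_of_int (frobenius_number (semigroup_quotient S d))
         = (real s + 1) / 2"
proof -
  have "s > 0" using \<open>a > 0\<close> \<open>a = s * d\<close> by simp
  have "odd s" "odd d" using \<open>odd a\<close> \<open>a = s * d\<close> by auto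
  have "coprime s k" "coprime d k" using \<open>coprime a k\<close> \<open>a = s * d\<close> by auto
  obtain r where r: "s = 2 * r + 1" using \<open>odd s\<close> by (auto elim: oddE)
  define T where "T = semigroup_quotient S d"
  define w where "w i = i * k + s * ((d * i + 1) div 2)" for i
  have bij: "bij_betw (\<lambda>i. w i mod s) {..<s} {..<s}"
    using bij_betw_mult_mod[OF \<open>coprime s k\<close> \<open>s > 0\<close>] by (simp add: w_def)
  have T: "T = {w i + s * q | i q. i < s}"
    unfolding T_def \<open>S = _\<close> \<open>a = s * d\<close> w_def
    using mem_quotient_three_term_iff[OF \<open>coprime d k\<close> \<open>d > 0\<close> \<open>s > 0\<close>] by blast
  have "w i \<le> w (2 * r)" if "i < s" for i
  proof -
    have "i \<le> 2 * r" using that r by simp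
    then show ?thesis unfolding w_def
      by (intro add_mono mult_le_mono div_le_mono order_refl)
  qed
  then have "frobenius_number T = int (w (2 * r)) - int s"
    using frobenius_number_of_apery[OF bij T \<open>s > 0\<close>, of "2 * r"] r by simp
  moreover have "w (2 * r) = 2 * r * k + s * (d * r)" by (simp add: w_def)
  ultimately have F: "real_of_int (frobenius_number T) = 2 * r * k + s * d * r - real s"
    by simp
  have gauss: "2 * (\<Sum>i<s. i) = s * (2 * r)"
    unfolding r by (induction r) (simp_all add: algebra_simps)
  have rounding: "2 * (\<Sum>i<s. (d * i + 1) div 2) = d * r * s + r"
    unfolding r by (rule sum_half_ceiling_odd_multiples[OF \<open>odd d\<close>])
  have "2 * (\<Sum>i<s. w i) = k * (2 * (\<Sum>i<s. i)) + s * (2 * (\<Sum>i<s. (d * i + 1) div 2))"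
    by (simp add: w_def sum.distrib sum_distrib_left algebra_simps)
  also have "\<dots> = s * (2 * r * k + d * r * s + r)"
    unfolding gauss rounding by (simp add: algebra_simps)
  finally have "s * (2 * genus T + 2 * r) = s * (2 * r * k + d * r * s + r)"
    using genus_of_apery[OF bij T \<open>s > 0\<close>] gauss by (simp add: algebra_simps)
  then have "2 * genus T + 2 * r = 2 * r * k + d * r * s + r" using \<open>s > 0\<close> by simp
  then have "2 * real (genus T) + 2 * r = 2 * r * k + d * r * s + real r"
    by (metis (mono_tags, lifting) of_nat_add of_nat_mult of_nat_numeral)
  then show ?thesis using F r unfolding T_def[symmetric] by (simp add: field_simps)
qed

end
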